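(* A Banach space with property $(\beta_p)$ for some $p\in(1,\infty)$ is umbel $p$-convex.
   Context: **Property $(\beta_p)$.** A Banach space $X$ with closed unit ball $B_X$ has property $(\beta_p)$ (property $(\beta)$ with power type $p$) if there is a constant $c>0$ such that for every $t>0$, every $z\in B_X$ and every sequence $\{x_n\}_{n\in\mathbb N}\subseteq B_X$ with $\inf_{i\neq j}\|x_i-x_j\|\ge t$, there is $i_0\in\mathbb N$ with $\|\frac{z-x_{i_0}}2\|\le1-\bar\beta(t)$, for some function $\bar\beta$ satisfying $\bar\beta(t)\ge t^p/c$ for all $t>0$. **Notation.** $\mathbb N=\{1,2,\dots\}$. $[\mathbb N]^{h}$ (resp. $[\mathbb N]^{\le h}$) is the set of subsets of $\mathbb N$ of size exactly $h$ (resp. at most $h$), whose elements are written as increasing tuples $\bar n=(n_1,\dots,n_\ell)$, $n_1<\dots<n_\ell$. $(\bar n,\bar\delta)$ or $(\bar n,j,\bar\eta)$ denotes concatenation, and "$(\bar n,\bar\delta)\in[\mathbb N]^{\le h}$" means that the concatenated tuple is strictly increasing and of length at most $h$. **Umbel $p$-convexity.** For $p\in(0,\infty)$, a metric space $(M,d)$ is umbel $p$-convex if there is a constant $\Pi>0$ such that for all $k\ge1$ and all $f\colon[\mathbb N]^{\le 2^k}\to M$, $$\sum_{s=1}^{k-1}\frac{1}{2^{k-1-s}}\sum_{t=1}^{2^{k-1-s}}\ \inf_{\bar n\in[\mathbb N]^{t2^{s+1}-2^s}}\ \inf_{\substack{\bar\delta\in[\mathbb N]^{2^s}:\\(\bar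 n,\bar\delta)\in[\mathbb N]^{\le 2^k}}}\ \liminf_{j\to\infty}\ \inf_{\substack{\bar\eta\in[\mathbb N]^{2^s-1}:\\(\bar n,j,\bar\eta)\in[\mathbb N]^{\le 2^k}}}\frac{d\big(f(\bar n,\bar\delta),f(\bar n,j,\bar\eta)\big)^p}{2^{sp}}\ \le\ \Pi^p\,\frac1{2^k}\sum_{\ell=1}^{2^k}\sup_{\bar n\in[\mathbb N]^\ell}d\big(f(n_1,\dots,n_{\ell-1}),f(n_1,\dots,n_\ell)\big)^p.$$ A Banach space is regarded as a metric space with the metric induced by its norm. *)

theory Defs
  imports "HOL-Analysis.Analysis"
begin

definition property_beta :: "real \<Rightarrow> 'a::banach itself \<Rightarrow> bool"
  where "property_beta p (_ :: 'a itself) \<longleftrightarrow>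
    (\<exists>c>0. \<exists>\<beta> :: real \<Rightarrow> real. (\<forall>t>0. \<beta> t \<ge> t powr p / c) \<and>
      (\<forall>t>0. \<forall>z \<in> cball (0::'a) 1. \<forall>x :: nat \<Rightarrow> 'a.
         range x \<subseteq> cball 0 1 \<longrightarrow>
         (INF (i, j) \<in> {(i, j). i \<noteq> j}. norm (x i - x j)) \<ge> t \<longrightarrow>
         (\<exists>i0. norm ((z - x i0) /\<^sub>R 2) \<le> 1 - \<beta> t)))"

text \<open>Finite sets of positive integers are represented by the strictly increasing lists of
  their elements, so that concatenation of tuples is list append.\<close>

definition incr_tuples :: "nat \<Rightarrow> nat list set"
  where "incr_tuples h = {ns. sorted_wrt (<) ns \<and> (\<forall>n \<in> set ns. 1 \<le> n) \<and> length ns = h}"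

definition incr_tuples_le :: "nat \<Rightarrow> nat list set"
  where "incr_tuples_le h = {ns. sorted_wrt (<) ns \<and> (\<forall>n \<in> set ns. 1 \<le> n) \<and> length ns \<le> h}"

text \<open>Both sides of the inequality live in \<^typ>\<open>ennreal\<close>: the suprema and lower limits may be
  infinite. For the finitely many \<open>j\<close> that cannot follow \<open>ns\<close> the innermost infimum is over
  the empty set and equals \<open>\<infinity>\<close>, which does not affect the lower limit.\<close>

definition (in Metric_space) umbel_convex :: "real \<Rightarrow> bool"
  where "umbel_convex p \<longleftrightarrow>
    (\<exists>C::real. C > 0 \<and> (\<forall>k::nat. k \<ge> 1 \<longrightarrow> (\<forall>f \<in> incr_tuples_le (2 ^ k) \<rightarrow> M.
      (\<Sum>s = 1..k - 1. 1 / 2 ^ (k - 1 - s) * (\<Sum>t = 1..2 ^ (k - 1 - s).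
         INF ns \<in> incr_tuples (t * 2 ^ (s + 1) - 2 ^ s).
         INF ds \<in> {ds \<in> incr_tuples (2 ^ s). ns @ ds \<in> incr_tuples_le (2 ^ k)}.
         liminf (\<lambda>j.
           INF es \<in> {es \<in> incr_tuples (2 ^ s - 1). ns @ j # es \<in> incr_tuples_le (2 ^ k)}.
           ennreal (d (f (ns @ ds)) (f (ns @ j # es)) powr p / 2 powr (real s * p)))))
      \<le> ennreal (C powr p) * (1 / 2 ^ k * (\<Sum>l = 1..2 ^ k.
           SUP ns \<in> incr_tuples l. ennreal (d (f (butlast ns)) (f ns) powr p))))))"

end

theory Submission imports Defs
begin

text \<open>Property \<open>(\<beta>\<^sub>p)\<close> self-improves to an inequality for a handle \<open>w\<close>, a point \<open>z\<close> and a sequence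
  \<open>x\<close> that is \<open>T\<close>-separated: some \<open>i\<close> satisfies
  \<open>(dist z (x i) / 2)\<^sup>p + K T\<^sup>p \<le> (a\<^sup>p + b\<^sup>p) / 2\<close> whenever \<open>dist z w \<le> a\<close> and
  \<open>dist w (x j) \<le> b\<close> for all \<open>j\<close>. Applied to the values of \<open>f\<close> at a tuple, an extension by
  \<open>2\<^sup>s\<close> entries and infinitely many further extensions by \<open>2\<^sup>s\<close> entries, it bounds the normalised
  displacement over \<open>2 \<cdot> 2\<^sup>s\<close> entries by the average of the two displacements over \<open>2\<^sup>s\<close> entries,
  minus a multiple of the \<open>(s, t)\<close> term of the umbel sum. Averaging over \<open>t\<close> and telescoping over
  \<open>s\<close> gives umbel convexity.\<close>

section \<open>Midpoint convexity of \<open>x powr p\<close>\<close>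

text \<open>The midpoint defect \<open>h\<close> is strictly decreasing on [0, 1] and vanishes at 1,
  so \<open>h (1/2)\<close> is positive and serves as \<open>g\<close>.\<close>

lemma powr_midpoint_gap:
  fixes p :: real
  assumes "1 < p"
  obtains g where "0 < g"
    and "\<And>x. 0 \<le> x \<Longrightarrow> x \<le> 1/2 \<Longrightarrow> ((1 + x) / 2) powr p + g \<le> (1 + x powr p) / 2"
proof -
  define h where "h x = (1 + x powr p) / 2 - ((1 + x) / 2) powr p" for x :: real
  have decr: "h y < h x" if "0 \<le> x" "x < y" "y \<le> 1" for x y
  proof (rule DERIV_neg_imp_decreasing_open[OF \<open>x < y\<close>])
    fix u assume u: "x < u" "u < y"
    then have "0 < u" "u < 1" using that by auto
    have "(h has_real_derivative (p / 2) * (u powr (p - 1) - ((1 + u) / 2) powr (p - 1))) (at u)"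
      unfolding h_def using \<open>0 < u\<close>
      by (auto intro!: derivative_eq_intros simp: field_simps)
    moreover have "u powr (p - 1) < ((1 + u) / 2) powr (p - 1)"
      using \<open>0 < u\<close> \<open>u < 1\<close> assms by (intro powr_less_mono2) auto
    then have "(p / 2) * (u powr (p - 1) - ((1 + u) / 2) powr (p - 1)) < 0"
      using assms by (intro mult_pos_neg) auto
    ultimately show "\<exists>D. (h has_real_derivative D) (at u) \<and> D < 0" by blast
  next
    show "continuous_on {x..y} h"
      unfolding h_def using that assms by (intro continuous_intros continuous_on_powr') auto
  qed
  have "h (1/2) > 0" using decr[of "1/2" 1] by (simp add: h_def)
  moreover have "h (1/2) \<le> h x" if "0 \<le> x" "x \<le> 1/2" for x
    using decr[of x "1/2"] that by (cases "x = 1/2", simp only: order_refl, simp)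
  ultimately show ?thesis
    by (intro that[of "h (1/2)"]) (auto simp: h_def algebra_simps)
qed

lemma powr_midpoint_le:
  fixes a b p :: real
  assumes "1 < p" "0 \<le> a" "0 \<le> b"
  shows "((a + b) / 2) powr p \<le> (a powr p + b powr p) / 2"
\<comment> \<open>Convexity is used on the open half-line only; with a zero argument the claim
  reduces to \<open>2 \<le> 2 powr p\<close>.\<close>
proof (cases "a = 0 \<or> b = 0")
  case True
  have "(x / 2) powr p \<le> x powr p / 2" if "0 \<le> x" for x :: real
  proof -
    have "2 powr 1 \<le> 2 powr p" using assms by (intro powr_mono) auto
    then have "x powr p / 2 powr p \<le> x powr p / 2" by (intro divide_left_mono) auto
    then show ?thesis using that by (simp add: powr_divide)
  qed
  then show ?thesis using True assms by auto
next
  case False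
  then have "convex_on {0<..} (\<lambda>x::real. x powr p)" "0 < a" "0 < b"
    using assms by (auto intro!: powr_convex)
  then show ?thesis
    using convex_onD[of "{0<..}" "\<lambda>x. x powr p" "1/2" a b] by (simp add: field_simps)
qed

section \<open>The inequality for a handle and a separated sequence\<close>

lemma property_beta_separatedE:
  assumes "property_beta p TYPE('a::banach)"
  obtains c where "0 < c"
    and "\<And>t (z::'a) x. 0 < t \<Longrightarrow> norm z \<le> 1 \<Longrightarrow> (\<And>i::nat. norm (x i) \<le> 1) \<Longrightarrow>
      (\<And>i j. i \<noteq> j \<Longrightarrow> t \<le> norm (x i - x j)) \<Longrightarrow> \<exists>i. norm (z - x i) / 2 \<le> 1 - t powr p / c"
proof -
  from assms obtain c \<beta> where c: "0 < c" and \<beta>: "\<forall>t>0. t powr p / c \<le> \<beta> t"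
    and *: "\<forall>t>0. \<forall>z \<in> cball (0::'a) 1. \<forall>x :: nat \<Rightarrow> 'a. range x \<subseteq> cball 0 1 \<longrightarrow>
         t \<le> (INF (i, j) \<in> {(i, j). i \<noteq> j}. norm (x i - x j)) \<longrightarrow>
         (\<exists>i0. norm ((z - x i0) /\<^sub>R 2) \<le> 1 - \<beta> t)"
    unfolding property_beta_def by (elim exE conjE) (rule that; assumption)
  show ?thesis
  proof (rule that[OF c])
    fix t and z :: 'a and x :: "nat \<Rightarrow> 'a"
    assume t: "0 < t" and zx: "norm z \<le> 1" "\<And>i. norm (x i) \<le> 1"
      and sep: "\<And>i j. i \<noteq> j \<Longrightarrow> t \<le> norm (x i - x j)"
    have "t \<le> (INF (i, j) \<in> {(i, j). i \<noteq> j}. norm (x i - x j))"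
    proof (rule cINF_greatest)
      have "(0, 1) \<in> {(i::nat, j). i \<noteq> j}" by simp
      then show "{(i::nat, j). i \<noteq> j} \<noteq> {}" by blast
    qed (use sep in auto)
    moreover have "range x \<subseteq> cball 0 1" "z \<in> cball 0 1" using zx by auto
    ultimately obtain i where "norm ((z - x i) /\<^sub>R 2) \<le> 1 - \<beta> t"
      using * t by blast
    then show "\<exists>i. norm (z - x i) / 2 \<le> 1 - t powr p / c"
      using \<beta> t by (intro exI[of _ i]) (auto dest!: spec[of _ t])
  qed
qed

text \<open>If the two radii are comparable, normalise both to one and apply property \<open>(\<beta>\<^sub>p)\<close>; otherwise
  the strict convexity of \<open>x\<^sup>p\<close> alone leaves enough room.\<close>
lemma property_beta_umbel_inequality:
  assumes p: "1 < p" and "property_beta p TYPE('a::banach)"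
  obtains K where "0 < K"
    and "\<And>a b T (w::'a) z x. 0 \<le> a \<Longrightarrow> 0 \<le> b \<Longrightarrow> 0 \<le> T \<Longrightarrow> dist z w \<le> a \<Longrightarrow> (\<And>i::nat. dist w (x i) \<le> b) \<Longrightarrow>
      (\<And>i j. i \<noteq> j \<Longrightarrow> T \<le> dist (x i) (x j)) \<Longrightarrow>
      \<exists>i. (dist z (x i) / 2) powr p + K * T powr p \<le> (a powr p + b powr p) / 2"
proof -
  obtain c where c: "0 < c"
    and beta: "\<And>t (z::'a) x. 0 < t \<Longrightarrow> norm z \<le> 1 \<Longrightarrow> (\<And>i::nat. norm (x i) \<le> 1) \<Longrightarrow>
      (\<And>i j. i \<noteq> j \<Longrightarrow> t \<le> norm (x i - x j)) \<Longrightarrow> \<exists>i. norm (z - x i) / 2 \<le> 1 - t powr p / c"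
    using property_beta_separatedE[OF assms(2)] by metis
  obtain g where g: "0 < g"
    and gap: "\<And>x. 0 \<le> x \<Longrightarrow> x \<le> 1/2 \<Longrightarrow> ((1 + x) / 2) powr p + g \<le> (1 + x powr p) / 2"
    using powr_midpoint_gap[OF p] by metis
  \<comment> \<open>One bound per case: the first for radii differing by a factor of at least 2,
    where \<open>T \<le> 2 * M\<close>; the second for comparable radii, where
    \<open>b \<le> 2 * m\<close>.\<close>
  define K where "K = min (g / 2 powr p) (1 / (2 powr p * c))"
  have "0 < K" using g c by (simp add: K_def)
  moreover have "\<exists>i. (dist z (x i) / 2) powr p + K * T powr p \<le> (a powr p + b powr p) / 2"
    if ab: "0 \<le> a" "0 \<le> b" and T: "0 \<le> T" and z: "dist z w \<le> a" and x: "\<And>i::nat. dist w (x i) \<le> b"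
      and sep: "\<And>i j. i \<noteq> j \<Longrightarrow> T \<le> dist (x i) (x j)" for a b T and w z :: 'a and x
  proof -
    have tri: "dist z (x i) \<le> a + b" for i
      using dist_triangle[of z "x i" w] z x[of i] by linarith
    then have conv: "(dist z (x i) / 2) powr p \<le> ((a + b) / 2) powr p" for i
      using p by (intro powr_mono2) auto
    have Tb: "T \<le> 2 * b"
      using sep[of 0 1] dist_triangle3[of "x 0" "x 1" w] x[of 0] x[of 1] by simp
    \<comment> \<open>\<open>T = 0\<close> is set apart because \<open>beta\<close> requires a
      positive separation; there convexity suffices.\<close>
    consider "T = 0" | "T > 0" "min a b \<le> max a b / 2" | "T > 0" "max a b / 2 < min a b"
      using T by linarith
    then show ?thesis
    proof cases
      case 1
      then show ?thesis using conv[of 0] powr_midpoint_le[OF p ab] by (auto intro!: exI[of _ 0])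
    next
      case 2
      \<comment> \<open>Scaling the larger radius to 1 leaves the ratio \<open>y\<close>, to which
        \<open>gap\<close> applies.\<close>
      define M where "M = max a b"
      define y where "y = min a b / M"
      have M: "0 < M" "T \<le> 2 * M" using 2 Tb by (auto simp: M_def)
      have y: "0 \<le> y" "y \<le> 1/2" using 2 M ab by (auto simp: y_def M_def[symmetric] field_simps)
      have ab_eq: "a + b = M * (1 + y)" "a powr p + b powr p = M powr p * (1 + y powr p)"
        using M ab by (auto simp: y_def M_def powr_divide field_simps min_def max_def)
      have "K * T powr p \<le> (g / 2 powr p) * (2 * M) powr p"
        using M T p g by (intro mult_mono powr_mono2) (auto simp: K_def)
      also have "\<dots> = M powr p * g" using M by (simp add: powr_mult)
      finally have "((a + b) / 2) powr p + K * T powr p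
          \<le> M powr p * (((1 + y) / 2) powr p + g)"
        using M y powr_mult[of M "(1 + y) / 2" p] by (simp add: ab_eq distrib_left)
      also have "\<dots> \<le> (a powr p + b powr p) / 2"
        using mult_left_mono[OF gap[OF y], of "M powr p"] by (simp add: ab_eq)
      finally show ?thesis using conv[of 0] by (auto intro!: exI[of _ 0])
    next
      case 3
      then have pos: "0 < a" "0 < b" using ab by (auto simp: min_def max_def split: if_splits)
      define m where "m = min a b"
      define u where "u = (a + b) / 2"
      have m: "0 < m" "m \<le> u" "u \<le> 2 * m" "b \<le> 2 * m" and "0 < u"
        using pos 3 by (auto simp: m_def u_def min_def max_def field_simps split: if_splits)
      have sc: "norm ((1 / r) *\<^sub>R v) \<le> 1" if "norm v \<le> r" "0 < r" for r and v :: 'a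
        using that by (simp add: field_simps)
      define z' where "z' = (1 / a) *\<^sub>R (z - w)"
      define X where "X i = (1 / b) *\<^sub>R (x i - w)" for i
      have z': "norm z' \<le> 1" and X: "norm (X i) \<le> 1" for i
        using z x[of i] pos by (auto intro!: sc simp: z'_def X_def dist_norm norm_minus_commute)
      moreover have "T / b \<le> norm (X i - X j)" if "i \<noteq> j" for i j
        using sep[OF that] pos
        by (simp add: X_def scaleR_diff_right[symmetric] dist_norm divide_right_mono)
      ultimately obtain i where i: "norm (z' - X i) / 2 \<le> 1 - (T / b) powr p / c"
        using beta[of "T / b" z' X] 3 pos by auto
      define e where "e = (T / b) powr p / c"
      have "0 \<le> e" using c by (simp add: e_def)
      moreover have "e \<le> 1" using i norm_ge_zero[of "z' - X i"] unfolding e_def by linarith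
      ultimately have e: "0 \<le> e" "e \<le> 1" .
      define x' where "x' = X i"
      have x': "norm x' \<le> 1" using X by (simp add: x'_def)
      have "z - x i = a *\<^sub>R z' - b *\<^sub>R x'" using pos by (simp add: z'_def x'_def X_def)
      \<comment> \<open>Only the common multiple \<open>m\<close> of the unit-ball difference gains
        from \<open>beta\<close>; the triangle inequality handles the remainder, giving a total gain
        of \<open>m * e\<close> after halving.\<close>
      also have "\<dots> = m *\<^sub>R (z' - x') + ((a - m) *\<^sub>R z' - (b - m) *\<^sub>R x')"
        by (simp add: algebra_simps)
      finally have "norm (z - x i) \<le> norm (m *\<^sub>R (z' - x')) + norm ((a - m) *\<^sub>R z' - (b - m) *\<^sub>R x')"
        using norm_triangle_ineq by (simp only:)
      also have "\<dots> \<le> norm (m *\<^sub>R (z' - x')) + (norm ((a - m) *\<^sub>R z') + norm ((b - m) *\<^sub>R x'))"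
        by (intro add_left_mono norm_triangle_ineq4)
      also have "\<dots> \<le> m * (2 * (1 - e)) + ((a - m) * 1 + (b - m) * 1)"
        unfolding norm_scaleR
      proof (intro add_mono mult_mono)
        show "norm (z' - x') \<le> 2 * (1 - e)" using i[folded e_def] unfolding x'_def by simp
      qed (use m(1) z' x' e in \<open>simp_all add: m_def\<close>)
      also have "\<dots> = 2 * (u - m * e)" by (simp add: u_def algebra_simps)
      finally have dist_le: "dist z (x i) / 2 \<le> u - m * e" by (simp add: dist_norm)
      have me: "0 \<le> m * e" using e m by simp
      have me_le: "m * e \<le> u" using e m mult_left_le[of e m] by linarith
      \<comment> \<open>Splitting off one factor turns the linear gain \<open>m * e\<close> into a
        gain of \<open>u powr (p - 1) * (m * e)\<close> in the p-th power.\<close>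
      have powr_split: "y powr p = y powr (p - 1) * y" if "0 \<le> y" for y :: real
        using powr_mult_base[OF that, of "p - 1"] by (simp add: mult.commute)
      have "(dist z (x i) / 2) powr p \<le> (u - m * e) powr p"
        using dist_le p by (intro powr_mono2) auto
      also have "\<dots> = (u - m * e) powr (p - 1) * (u - m * e)"
        using me_le by (intro powr_split) simp
      also have "\<dots> \<le> u powr (p - 1) * (u - m * e)"
        using me me_le p by (intro mult_right_mono powr_mono2) auto
      also have "\<dots> = u powr p - u powr (p - 1) * (m * e)"
        using powr_split[of u] \<open>0 < u\<close> by (simp add: right_diff_distrib)
      finally have 1: "(dist z (x i) / 2) powr p \<le> u powr p - u powr (p - 1) * (m * e)" .
      \<comment> \<open>The gain absorbs the separation term because
        \<open>b / 2 \<le> m \<le> u\<close>.\<close>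
      have "K * T powr p \<le> 1 / (2 powr p * c) * T powr p"
        by (intro mult_right_mono) (auto simp: K_def)
      also have "\<dots> = (b / 2) powr p * e"
        using pos T by (simp add: e_def powr_divide)
      also have "\<dots> \<le> m powr p * e"
        using m pos p e by (intro mult_right_mono powr_mono2) auto
      also have "\<dots> = m powr (p - 1) * (m * e)"
        using powr_split[of m] m by simp
      also have "\<dots> \<le> u powr (p - 1) * (m * e)"
        using m p me by (intro mult_right_mono powr_mono2) auto
      finally have "(dist z (x i) / 2) powr p + K * T powr p \<le> u powr p" using 1 by simp
      then show ?thesis unfolding u_def using powr_midpoint_le[OF p ab] by (meson order_trans)
    qed
  qed
  ultimately show ?thesis by (rule that)
qed

section \<open>Bounds on normalised displacements and their doubling\<close>

lemma powr_le_iff_le_powr_inverse: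
  fixes x v p :: real
  assumes "0 < p" "0 \<le> x" "0 \<le> v"
  shows "x powr p \<le> v \<longleftrightarrow> x \<le> v powr (1 / p)"
proof -
  have "(v powr (1 / p)) powr p = v" using assms by (simp add: powr_powr)
  then show ?thesis
    using assms powr_mono2[of p x "v powr (1 / p)"] powr_less_mono2[of p "v powr (1 / p)" x]
    by (metis less_imp_le not_less powr_ge_zero)
qed

text \<open>\<open>v\<close> bounds the supremum over \<open>ns\<close> of the lower limits, in the first entry of \<open>ds\<close>, of the
  normalised displacement. Only extensions beyond every \<open>N\<close>, not all of them, are controlled, because
  property \<open>(\<beta>\<^sub>p)\<close> only provides a single good index in each sequence.\<close>
definition reaches :: "(nat list \<Rightarrow> 'a::metric_space) \<Rightarrow> real \<Rightarrow> nat \<Rightarrow> nat \<Rightarrow> real \<Rightarrow> bool"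
  where "reaches f p m h v \<longleftrightarrow>
    (\<forall>ns \<in> incr_tuples m. \<forall>N. \<exists>ds \<in> incr_tuples h. ns @ ds \<in> incr_tuples (m + h) \<and>
      (\<forall>d \<in> set ds. N < d) \<and> (dist (f ns) (f (ns @ ds)) / h) powr p \<le> v)"

text \<open>The bound is never vacuous, since \<open>[1..<Suc m]\<close> is an admissible tuple.
  This later excludes infinite \<open>T s t\<close> and discards the last term of the telescoping
  sum.\<close>

lemma reaches_nonneg:
  assumes "reaches f p m h v"
  shows "0 \<le> v"
proof -
  have "[1..<Suc m] \<in> incr_tuples m" by (auto simp: incr_tuples_def simp del: upt_Suc)
  then obtain ds where "(dist (f [1..<Suc m]) (f ([1..<Suc m] @ ds)) / h) powr p \<le> v"
    using assms unfolding reaches_def by blast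
  then show ?thesis using powr_ge_zero order_trans by blast
qed

text \<open>The end points reached from a middle tuple are thinned out to a separated sequence, so that
  the umbel inequality applies with the middle tuple as handle.\<close>
lemma reaches_double:
  fixes f :: "nat list \<Rightarrow> 'a::metric_space"
  assumes p: "0 < p" and h: "0 < h" and \<tau>: "0 \<le> \<tau>"
    and umbel: "\<And>a b T (w::'a) z x. 0 \<le> a \<Longrightarrow> 0 \<le> b \<Longrightarrow> 0 \<le> T \<Longrightarrow> dist z w \<le> a \<Longrightarrow>
      (\<And>i::nat. dist w (x i) \<le> b) \<Longrightarrow> (\<And>i j. i \<noteq> j \<Longrightarrow> T \<le> dist (x i) (x j)) \<Longrightarrow>
      \<exists>i. (dist z (x i) / 2) powr p + K * T powr p \<le> (a powr p + b powr p) / 2"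
    and a: "reaches f p m h a" and b: "reaches f p (m + h) h b"
    and sep: "\<And>ns ds. ns \<in> incr_tuples (m + h) \<Longrightarrow> ds \<in> incr_tuples h \<Longrightarrow> ns @ ds \<in> incr_tuples (m + 2 * h) \<Longrightarrow>
      \<exists>J. \<forall>j\<ge>J. \<forall>es \<in> incr_tuples (h - 1). ns @ j # es \<in> incr_tuples (m + 2 * h) \<longrightarrow>
        \<tau> \<le> (dist (f (ns @ ds)) (f (ns @ j # es)) / h) powr p"
  shows "reaches f p m (2 * h) ((a + b) / 2 - K * \<tau>)"
  unfolding reaches_def
proof (intro ballI allI)
  fix ns N assume "ns \<in> incr_tuples m"
  then obtain ds where ds: "ds \<in> incr_tuples h" "ns @ ds \<in> incr_tuples (m + h)" "\<forall>d \<in> set ds. N < d"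
    and za: "(dist (f ns) (f (ns @ ds)) / h) powr p \<le> a"
    using a unfolding reaches_def by blast
  let ?n = "ns @ ds"
  \<comment> \<open>Entries exceed \<open>N\<close> for the conclusion, and \<open>i\<close> so that
    the first entries of the extensions are unbounded and eventually come under
    \<open>sep\<close>.\<close>
  have "\<forall>i. \<exists>es \<in> incr_tuples h. ?n @ es \<in> incr_tuples (m + h + h) \<and>
      (\<forall>d \<in> set es. max N i < d) \<and> (dist (f ?n) (f (?n @ es)) / h) powr p \<le> b"
    using b ds(2) unfolding reaches_def by blast
  then obtain E where E: "\<And>i. E i \<in> incr_tuples h" "\<And>i. ?n @ E i \<in> incr_tuples (m + 2 * h)"
    "\<And>i d. d \<in> set (E i) \<Longrightarrow> max N i < d"
    and xb: "\<And>i. (dist (f ?n) (f (?n @ E i)) / h) powr p \<le> b"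
    by (metis add.assoc mult_2)
  have E_Cons: "E i = hd (E i) # tl (E i)" "tl (E i) \<in> incr_tuples (h - 1)" "i < hd (E i)" for i
  proof -
    have "E i \<noteq> []" using E(1)[of i] h by (auto simp: incr_tuples_def)
    then obtain j es where je: "E i = j # es" by (cases "E i") auto
    then show "E i = hd (E i) # tl (E i)" "tl (E i) \<in> incr_tuples (h - 1)" "i < hd (E i)"
      using E(1)[of i] E(3)[of j i] by (auto simp: incr_tuples_def)
  qed
  have "\<forall>i. \<exists>J. \<forall>j\<ge>J. \<forall>es \<in> incr_tuples (h - 1). ?n @ j # es \<in> incr_tuples (m + 2 * h) \<longrightarrow>
        \<tau> \<le> (dist (f (?n @ E i)) (f (?n @ j # es)) / h) powr p"
    using sep[OF ds(2) E(1) E(2)] by blast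
  then obtain J where J: "\<And>i j es. J i \<le> j \<Longrightarrow> es \<in> incr_tuples (h - 1) \<Longrightarrow>
      ?n @ j # es \<in> incr_tuples (m + 2 * h) \<Longrightarrow>
      \<tau> \<le> (dist (f (?n @ E i)) (f (?n @ j # es)) / h) powr p"
    by metis
  \<comment> \<open>Each chosen index passes the threshold \<open>J\<close> of all earlier ones, and
    \<open>E i\<close> starts beyond \<open>i\<close>; hence the subsequence is separated.\<close>
  define r where "r = rec_nat 0 (\<lambda>_ i. max (Suc i) (J i))"
  have r_Suc: "r (Suc l) = max (Suc (r l)) (J (r l))" for l by (simp add: r_def)
  have "strict_mono r" by (rule strict_mono_Suc_iff[THEN iffD2]) (simp add: r_Suc less_max_iff_disj)
  then have r: "J (r l) \<le> r l'" if "l < l'" for l l'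
    using strict_mono_leD[of r "Suc l" l'] r_Suc[of l] that by simp
  define x where "x l = f (?n @ E (r l))" for l
  have less_sep: "\<tau> \<le> (dist (x l) (x l') / h) powr p" if "l < l'" for l l'
    using J[of "r l" "hd (E (r l'))" "tl (E (r l'))"] r[OF that] E_Cons[of "r l'"] E(2)[of "r l'"]
    by (simp add: x_def)
  then have x_sep: "\<tau> \<le> (dist (x l) (x l') / h) powr p" if "l \<noteq> l'" for l l'
    using that by (metis dist_commute linorder_neqE_nat)
  note nonneg = reaches_nonneg[OF a] reaches_nonneg[OF b]
  have scale: "(h * v powr (1 / p)) powr p = h powr p * v" if "0 \<le> v" for v :: real
    using p that by (simp add: powr_mult powr_powr)
  \<comment> \<open>The radii undo the normalisation by \<open>h\<close> and the p-th power.
    Afterwards \<open>h powr p\<close> cancels, and the halved distance becomes the displacement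
    normalised by \<open>2 * h\<close>.\<close>
  have "\<exists>i. (dist (f ns) (x i) / 2) powr p + K * (h * \<tau> powr (1 / p)) powr p
      \<le> ((h * a powr (1 / p)) powr p + (h * b powr (1 / p)) powr p) / 2"
  proof (rule umbel)
    show "dist (f ns) (f ?n) \<le> h * a powr (1 / p)"
      using za p h nonneg by (simp add: powr_le_iff_le_powr_inverse field_simps)
    show "dist (f ?n) (x i) \<le> h * b powr (1 / p)" for i
      using xb[of "r i"] p h nonneg by (simp add: x_def powr_le_iff_le_powr_inverse field_simps)
    show "h * \<tau> powr (1 / p) \<le> dist (x i) (x j)" if "i \<noteq> j" for i j
    proof -
      have "\<tau> powr (1 / p) \<le> ((dist (x i) (x j) / h) powr p) powr (1 / p)"
        using x_sep[OF that] \<tau> p by (intro powr_mono2) auto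
      then show ?thesis using p h by (simp add: powr_powr field_simps)
    qed
  qed auto
  then obtain i where "(dist (f ns) (x i) / 2) powr p + K * (h powr p * \<tau>)
      \<le> (h powr p * a + h powr p * b) / 2"
    using scale \<tau> nonneg by auto
  then have "(dist (f ns) (x i) / 2) powr p \<le> h powr p * ((a + b) / 2 - K * \<tau>)"
    by (simp add: field_simps)
  moreover have "(dist (f ns) (x i) / 2) powr p = h powr p * (dist (f ns) (x i) / (2 * h)) powr p"
    using h by (simp add: powr_mult[symmetric])
  ultimately have "(dist (f ns) (x i) / real (2 * h)) powr p \<le> (a + b) / 2 - K * \<tau>"
    using h by simp
  moreover have "ds @ E (r i) \<in> incr_tuples (2 * h)" "\<forall>d \<in> set (ds @ E (r i)). N < d"
    using ds E(1,2)[of "r i"] E(3)[of _ "r i"] by (auto simp: incr_tuples_def sorted_wrt_append)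
  ultimately show "\<exists>es \<in> incr_tuples (2 * h). ns @ es \<in> incr_tuples (m + 2 * h) \<and>
      (\<forall>d \<in> set es. N < d) \<and> (dist (f ns) (f (ns @ es)) / real (2 * h)) powr p \<le> (a + b) / 2 - K * \<tau>"
    using E(2)[of "r i"] by (intro bexI[of _ "ds @ E (r i)"]) (simp_all add: x_def)
qed

section \<open>Averaging over blocks and telescoping over scales\<close>

lemma sum_atLeastAtMost_double:
  fixes g :: "nat \<Rightarrow> 'a::comm_monoid_add"
  shows "(\<Sum>t = 1..2 * n. g t) = (\<Sum>t = 1..n. g (2 * t - 1) + g (2 * t))"
  by (induction n) (simp_all add: add.assoc)

lemma ennreal_divide_power2: "x / 2 ^ n = ennreal (1 / 2 ^ n) * x"
proof -
  have "ennreal (1 / 2 ^ n) = ennreal 1 / ennreal (2 ^ n)" by (subst divide_ennreal) auto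
  also have "\<dots> = 1 / 2 ^ n" by (simp add: ennreal_power[symmetric])
  finally show ?thesis by (simp add: ennreal_times_divide mult.commute)
qed

theorem corollary13:
  fixes p :: real
  assumes "1 < p"
    and "property_beta p TYPE('a::banach)"
  shows "Metric_space.umbel_convex (UNIV :: 'a set) dist p"
proof -
  obtain K where K: "0 < K"
    and umbel: "\<And>a b T (w::'a) z x. 0 \<le> a \<Longrightarrow> 0 \<le> b \<Longrightarrow> 0 \<le> T \<Longrightarrow> dist z w \<le> a \<Longrightarrow> (\<And>i::nat. dist w (x i) \<le> b) \<Longrightarrow>
      (\<And>i j. i \<noteq> j \<Longrightarrow> T \<le> dist (x i) (x j)) \<Longrightarrow>
      \<exists>i. (dist z (x i) / 2) powr p + K * T powr p \<le> (a powr p + b powr p) / 2"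
    using property_beta_umbel_inequality[OF assms] by metis
  \<comment> \<open>Chosen so that \<open>C powr p\<close> is the factor obtained on solving the
    telescoped inequality for the \<open>B\<close> terms.\<close>
  define C where "C = (2 / K) powr (1 / p)"
  have C: "0 < C" "C powr p = 2 / K" using K assms(1) by (simp_all add: C_def powr_powr)
  have "(\<Sum>s = 1..k - 1. 1 / 2 ^ (k - 1 - s) * (\<Sum>t = 1..2 ^ (k - 1 - s).
         INF ns \<in> incr_tuples (t * 2 ^ (s + 1) - 2 ^ s).
         INF ds \<in> {ds \<in> incr_tuples (2 ^ s). ns @ ds \<in> incr_tuples_le (2 ^ k)}.
         liminf (\<lambda>j.
           INF es \<in> {es \<in> incr_tuples (2 ^ s - 1). ns @ j # es \<in> incr_tuples_le (2 ^ k)}.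
           ennreal (dist (f (ns @ ds)) (f (ns @ j # es)) powr p / 2 powr (real s * p)))))
      \<le> ennreal (C powr p) * (1 / 2 ^ k * (\<Sum>l = 1..2 ^ k.
           SUP ns \<in> incr_tuples l. ennreal (dist (f (butlast ns)) (f ns) powr p)))"
    if k: "1 \<le> k" for k :: nat and f :: "nat list \<Rightarrow> 'a"
  proof -
    define T where "T s t =
        (INF ns \<in> incr_tuples (t * 2 ^ (s + 1) - 2 ^ s).
         INF ds \<in> {ds \<in> incr_tuples (2 ^ s). ns @ ds \<in> incr_tuples_le (2 ^ k)}.
         liminf (\<lambda>j.
           INF es \<in> {es \<in> incr_tuples (2 ^ s - 1). ns @ j # es \<in> incr_tuples_le (2 ^ k)}.
           ennreal (dist (f (ns @ ds)) (f (ns @ j # es)) powr p / 2 powr (real s * p))))" for s t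
    define S where "S l = (SUP ns \<in> incr_tuples l. ennreal (dist (f (butlast ns)) (f ns) powr p))" for l
    have "(\<Sum>s = 1..k - 1. 1 / 2 ^ (k - 1 - s) * (\<Sum>t = 1..2 ^ (k - 1 - s). T s t))
        \<le> ennreal (C powr p) * (1 / 2 ^ k * (\<Sum>l = 1..2 ^ k. S l))"
    proof (cases "\<exists>l \<in> {1..2 ^ k}. S l = \<infinity>")
      case True
      then have "(\<Sum>l = 1..2 ^ k. S l) = \<infinity>" by (simp add: infinity_ennreal_def)
      then show ?thesis
        using C K unfolding ennreal_divide_power2[of 1] by (simp only:) (simp add: ennreal_mult_top)
    next
      case False
      \<comment> \<open>Half of \<open>T s t\<close> is strictly below the lower limits in \<open>T s t\<close>, so it is an eventual
        lower bound of the distances; this costs the factor 2 in \<open>C\<close>.\<close>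
      define v where "v = rec_nat (\<lambda>l. enn2real (S l))
        (\<lambda>s w t. (w (2 * t - 1) + w (2 * t)) / 2 - K * (enn2real (T s t) / 2))"
      have v_0: "v 0 l = enn2real (S l)"
        and v_Suc: "v (Suc s) t = (v s (2 * t - 1) + v s (2 * t)) / 2 - K * (enn2real (T s t) / 2)" for l s t
        by (simp_all add: v_def)
      have S_eq: "S l = ennreal (v 0 l)" if "l \<in> {1..2 ^ k}" for l
        using False that by (simp add: v_0 less_top[symmetric])
      have halves: "2 * t - 1 \<in> {1..2 ^ (k - s)}" "2 * t \<in> {1..2 ^ (k - s)}"
        if "s < k" "t \<in> {1..2 ^ (k - 1 - s)}" for s t :: nat
      proof -
        have "k - s = Suc (k - 1 - s)" using that by simp
        then have "(2::nat) ^ (k - s) = 2 * 2 ^ (k - 1 - s)" by (simp only: power_Suc)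
        then show "2 * t - 1 \<in> {1..2 ^ (k - s)}" "2 * t \<in> {1..2 ^ (k - s)}" using that by auto
      qed
      \<comment> \<open>Blocks are numbered from 1: block \<open>t\<close> at scale
        \<open>Suc s\<close> consists of blocks \<open>2 * t - 1\<close> and \<open>2 * t\<close> at
        scale \<open>s\<close>. The alternative \<open>\<tau> = 0\<close> covers a vanishing
        \<open>T s t\<close>.\<close>
      have double: "reaches f p ((t - 1) * 2 ^ Suc s) (2 ^ Suc s) ((a + b) / 2 - K * \<tau>)"
        if s: "s < k" and t: "t \<in> {1..2 ^ (k - 1 - s)}"
          and a: "reaches f p ((2 * t - 1 - 1) * 2 ^ s) (2 ^ s) a"
          and b: "reaches f p ((2 * t - 1) * 2 ^ s) (2 ^ s) b"
          and \<tau>: "0 \<le> \<tau>" "\<tau> = 0 \<or> ennreal \<tau> < T s t" for s t a b \<tau>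
      proof -
        define m h where "m = (t - 1) * 2 ^ Suc s" and "h = (2::nat) ^ s"
        have start: "(2 * t - 1 - 1) * 2 ^ s = m" by (simp add: m_def diff_mult_distrib)
        \<comment> \<open>The tuple at the midpoint of the block has exactly the length of
          \<open>ns\<close> in \<open>T s t\<close>.\<close>
        have mid: "(2 * t - 1) * 2 ^ s = m + h" "t * 2 ^ (s + 1) - 2 ^ s = m + h"
          using t by (cases t; simp add: m_def h_def)+
        have "m + 2 * h = t * 2 ^ Suc s" using t by (cases t; simp add: m_def h_def)
        also have "\<dots> \<le> 2 ^ (k - 1 - s) * 2 ^ Suc s" using t by (intro mult_right_mono) auto
        also have "\<dots> = 2 ^ k" using s by (simp only: power_add[symmetric]) simp
        finally have "m + 2 * h \<le> 2 ^ k" .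
        then have le: "ns \<in> incr_tuples_le (2 ^ k)" if "ns \<in> incr_tuples (m + 2 * h)" for ns
          using that by (simp add: incr_tuples_def incr_tuples_le_def)
        have h_powr: "y powr p / 2 powr (real s * p) = (y / h) powr p" if "0 \<le> y" for y :: real
          using that by (simp add: h_def powr_divide powr_powr[symmetric] powr_realpow)
        have "reaches f p m (2 * h) ((a + b) / 2 - K * \<tau>)"
        proof (rule reaches_double[where K = K])
          show "reaches f p m h a" "reaches f p (m + h) h b"
            using a b unfolding start mid(1) by (simp_all add: h_def)
          fix ns ds
          assume ns: "ns \<in> incr_tuples (m + h)" and ds: "ds \<in> incr_tuples h" "ns @ ds \<in> incr_tuples (m + 2 * h)"
          show "\<exists>J. \<forall>j\<ge>J. \<forall>es \<in> incr_tuples (h - 1). ns @ j # es \<in> incr_tuples (m + 2 * h) \<longrightarrow>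
              \<tau> \<le> (dist (f (ns @ ds)) (f (ns @ j # es)) / h) powr p"
          proof (cases "\<tau> = 0")
            case False
            then have "ennreal \<tau> < T s t" using \<tau> by simp
            then have "ennreal \<tau> < liminf (\<lambda>j.
                INF es \<in> {es \<in> incr_tuples (2 ^ s - 1). ns @ j # es \<in> incr_tuples_le (2 ^ k)}.
                ennreal (dist (f (ns @ ds)) (f (ns @ j # es)) powr p / 2 powr (real s * p)))"
              unfolding T_def mid using ns ds le h_def by (force dest!: less_INF_D)
            from less_LiminfD[OF this] obtain J where J: "\<And>j. J \<le> j \<Longrightarrow> ennreal \<tau> <
                (INF es \<in> {es \<in> incr_tuples (2 ^ s - 1). ns @ j # es \<in> incr_tuples_le (2 ^ k)}.
                ennreal (dist (f (ns @ ds)) (f (ns @ j # es)) powr p / 2 powr (real s * p)))"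
              unfolding eventually_sequentially by blast
            show ?thesis
            proof (intro exI[of _ J] allI impI ballI)
              fix j es assume "J \<le> j" "es \<in> incr_tuples (h - 1)" "ns @ j # es \<in> incr_tuples (m + 2 * h)"
              then have "ennreal \<tau> < ennreal (dist (f (ns @ ds)) (f (ns @ j # es)) powr p / 2 powr (real s * p))"
                using le by (intro less_INF_D[OF J]) (auto simp: h_def)
              then show "\<tau> \<le> (dist (f (ns @ ds)) (f (ns @ j # es)) / h) powr p"
                using \<tau> by (simp add: h_powr ennreal_less_iff)
            qed
          qed simp
        qed (use assms(1) \<tau> umbel in \<open>auto simp: h_def\<close>)
        then show ?thesis by (simp add: m_def h_def)
      qed
      \<comment> \<open>An infinite term would admit every \<open>\<tau>\<close>;
        \<open>(a + b + 1) / K\<close> makes the doubled bound negative. Finiteness matters because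
        \<open>enn2real\<close> sends infinity to 0.\<close>
      have finite_T: "T s t < \<infinity>"
        if "s < k" "t \<in> {1..2 ^ (k - 1 - s)}" "reaches f p ((2 * t - 1 - 1) * 2 ^ s) (2 ^ s) a"
          "reaches f p ((2 * t - 1) * 2 ^ s) (2 ^ s) b" for s t a b
      proof (rule ccontr)
        assume "\<not> T s t < \<infinity>"
        then have "ennreal \<tau> < T s t" for \<tau> by (simp add: less_top[symmetric])
        moreover have ab: "0 \<le> a" "0 \<le> b" using that reaches_nonneg by blast+
        ultimately have "0 \<le> (a + b) / 2 - K * ((a + b + 1) / K)"
          using that K by (intro reaches_nonneg[OF double]) auto
        then show False using ab K by simp
      qed
      \<comment> \<open>\<open>v s t\<close> belongs to the \<open>t\<close>-th block of length
        \<open>2 ^ s\<close>: single steps are bounded by \<open>S t\<close>, and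
        \<open>double\<close> merges neighbouring blocks.\<close>
      have v: "reaches f p ((t - 1) * 2 ^ s) (2 ^ s) (v s t)" if "s \<le> k" "t \<in> {1..2 ^ (k - s)}" for s t
        using that
      proof (induction s arbitrary: t)
        case 0
        have "(dist (f ns) (f (ns @ [d])) / 1) powr p \<le> v 0 t" if "ns @ [d] \<in> incr_tuples t" for ns d
        proof -
          have "ennreal (dist (f (butlast (ns @ [d]))) (f (ns @ [d])) powr p) \<le> S t"
            unfolding S_def using that by (rule SUP_upper)
          then have "ennreal (dist (f ns) (f (ns @ [d])) powr p) \<le> ennreal (v 0 t)"
            using S_eq[of t] 0 by simp
          then show ?thesis by (simp add: v_0)
        qed
        note step = this
        show ?case
          unfolding reaches_def
        proof (intro ballI allI)
          fix ns N assume ns: "ns \<in> incr_tuples ((t - 1) * 2 ^ 0)"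
          define d where "d = Suc (Max (insert N (set ns)))"
          have "N < d" "\<forall>x \<in> set ns. x < d" by (simp_all add: d_def less_Suc_eq_le)
          moreover from this have "ns @ [d] \<in> incr_tuples t" "[d] \<in> incr_tuples 1"
            using ns 0 by (auto simp: incr_tuples_def sorted_wrt_append)
          ultimately show "\<exists>ds \<in> incr_tuples (2 ^ 0). ns @ ds \<in> incr_tuples ((t - 1) * 2 ^ 0 + 2 ^ 0) \<and>
              (\<forall>d \<in> set ds. N < d) \<and> (dist (f ns) (f (ns @ ds)) / real (2 ^ 0)) powr p \<le> v 0 t"
            using step[of ns d] 0 by (intro bexI[of _ "[d]"]) auto
        qed
      next
        case (Suc s)
        then have t: "s < k" "t \<in> {1..2 ^ (k - 1 - s)}" by auto
        then have ab: "reaches f p ((2 * t - 1 - 1) * 2 ^ s) (2 ^ s) (v s (2 * t - 1))"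
          "reaches f p ((2 * t - 1) * 2 ^ s) (2 ^ s) (v s (2 * t))"
          using Suc.IH[of "2 * t - 1"] Suc.IH[of "2 * t"] halves[OF t] t by simp_all
        have "ennreal (enn2real (T s t) / 2) < T s t" if "T s t \<noteq> 0"
        proof -
          have T: "T s t = ennreal (enn2real (T s t))" using finite_T[OF t ab] by simp
          then have "0 < enn2real (T s t)" using that by (metis enn2real_nonneg ennreal_0 less_eq_real_def)
          then show ?thesis by (subst (2) T) (simp add: ennreal_less_iff)
        qed
        then have "enn2real (T s t) / 2 = 0 \<or> ennreal (enn2real (T s t) / 2) < T s t"
          by (cases "T s t = 0") simp_all
        then show ?case unfolding v_Suc by (intro double[OF t ab]) simp_all
      qed
      \<comment> \<open>\<open>A s\<close> is the mean block bound at scale \<open>s\<close>, and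
        \<open>B s\<close> the real value of the \<open>s\<close>-summand on the left; passing to
        the next scale lowers the mean by \<open>K / 2 * B s\<close>.\<close>
      define A where "A s = (\<Sum>t = 1..2 ^ (k - s). v s t) / 2 ^ (k - s)" for s
      define B where "B s = (\<Sum>t = 1..2 ^ (k - 1 - s). 2 * (enn2real (T s t) / 2)) / 2 ^ (k - 1 - s)" for s
      have A_Suc: "A s - A (Suc s) = K / 2 * B s" if "s < k" for s
      proof -
        define n where "n = k - 1 - s"
        have n: "k - s = Suc n" "k - Suc s = n" using that by (auto simp: n_def)
        have "A s = (\<Sum>t = 1..2 ^ n. (v s (2 * t - 1) + v s (2 * t)) / 2) / 2 ^ n"
          using sum_atLeastAtMost_double[of "v s" "2 ^ n"]
          by (simp add: A_def n sum_divide_distrib[symmetric])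
        then show ?thesis
          by (simp add: A_def B_def n n_def[symmetric] v_Suc sum_subtractf diff_divide_distrib
              sum_distrib_left[symmetric] sum_divide_distrib[symmetric])
      qed
      have "(\<Sum>s<k. K / 2 * B s) = (\<Sum>s<k. A s - A (Suc s))" by (simp add: A_Suc)
      also have "\<dots> = A 0 - A k" by (rule sum_lessThan_telescope')
      \<comment> \<open>At scale \<open>k\<close> a single block remains, so
        \<open>A k = v k 1\<close>.\<close>
      also have "\<dots> \<le> A 0" using reaches_nonneg[OF v[of k 1]] by (simp add: A_def)
      finally have "K / 2 * (\<Sum>s<k. B s) \<le> A 0" by (simp add: sum_distrib_left)
      moreover have B_nonneg: "0 \<le> B s" for s by (auto simp: B_def intro!: divide_nonneg_pos sum_nonneg)
      \<comment> \<open>The umbel sum starts at 1, so the non-negative term \<open>B 0\<close> is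
        dropped.\<close>
      then have "(\<Sum>s = 1..k - 1. B s) \<le> (\<Sum>s<k. B s)" using k by (intro sum_mono2) auto
      ultimately have B_le: "(\<Sum>s = 1..k - 1. B s) \<le> 2 / K * A 0"
        using K by (simp add: field_simps) (meson mult_left_mono order_trans less_imp_le)
      have "1 / 2 ^ (k - 1 - s) * (\<Sum>t = 1..2 ^ (k - 1 - s). T s t) = ennreal (B s)"
        if "s \<in> {1..k - 1}" for s
      proof -
        have "T s t = ennreal (enn2real (T s t))" if "t \<in> {1..2 ^ (k - 1 - s)}" for t
        proof -
          have t: "s < k" "t \<in> {1..2 ^ (k - 1 - s)}" using that \<open>s \<in> {1..k - 1}\<close> by auto
          have "T s t < \<infinity>"
            using v[of s "2 * t - 1"] v[of s "2 * t"] halves[OF t] t by (intro finite_T[OF t]) simp_all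
          then show ?thesis by simp
        qed
        then have "(\<Sum>t = 1..2 ^ (k - 1 - s). T s t) = (\<Sum>t = 1..2 ^ (k - 1 - s). ennreal (enn2real (T s t)))"
          by (intro sum.cong) auto
        then show ?thesis
          by (simp add: B_def ennreal_divide_power2 sum_ennreal sum_nonneg flip: ennreal_mult)
      qed
      then have "(\<Sum>s = 1..k - 1. 1 / 2 ^ (k - 1 - s) * (\<Sum>t = 1..2 ^ (k - 1 - s). T s t))
          = ennreal (\<Sum>s = 1..k - 1. B s)"
        using B_nonneg by (simp add: sum_ennreal)
      also have "\<dots> \<le> ennreal (2 / K * A 0)" using B_le by (rule ennreal_leI)
      also have "\<dots> = ennreal (2 / K) * ennreal (A 0)"
        using K by (intro ennreal_mult) (auto simp: A_def v_0 intro!: divide_nonneg_pos sum_nonneg)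
      also have "ennreal (A 0) = 1 / 2 ^ k * (\<Sum>l = 1..2 ^ k. S l)"
      proof -
        have "(\<Sum>l = 1..2 ^ k. S l) = (\<Sum>l = 1..2 ^ k. ennreal (v 0 l))"
          using S_eq by (intro sum.cong) auto
        then show ?thesis
          by (simp add: A_def v_0 ennreal_divide_power2 sum_ennreal sum_nonneg flip: ennreal_mult)
      qed
      finally show ?thesis by (simp add: C)
    qed
    then show ?thesis by (simp only: T_def S_def)
  qed
  then show ?thesis
    unfolding Metric_space.umbel_convex_def[OF Met_TC.Metric_space_axioms] using C by blast
qed

end
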